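(* Let $a,b,c,d$ be positive integers with $ad > bc$ and $\gcd(a,b) = \gcd(c,d) = 1$, and let $x, y \in \mathbb{Z}$ satisfy $ax + by = 1$. Then \begin{align*} &uv(u-1) \left( u^a v^b -1 \right) \mathrm{c}\left( v, u; d, c \right) + uv (v-1) \left( u^c v^d - 1 \right) \mathrm{c}\left( u, v; a, b \right) \\ &\qquad + u^{ a-y } v^{ b+x } \left( u-1 \right) \left( v-1 \right) \mathrm{c}\left( u^a v^b , u^{-y} v^x ; cx+dy , ad-bc \right) \\ &\qquad = u^{ a+c } v^{ b+d } - u^a v^b (uv-v+1) - u^c v^d (uv-u+1) + uv . \end{align*}
   Context: For positive integers $a,b$ and indeterminates $u,v$, the Dedekind--Carlitz polynomial is $\mathrm{c}(u,v;a,b) := \sum_{k=1}^{b-1} u^{\lfloor ka/b\rfloor} v^{k-1}$; the indeterminates may be replaced by Laurent monomials (as in $\mathrm{c}(u^a v^b, u^{-y}v^x; \cdot,\cdot)$), and the identity is one of Laurent polynomials in $u,v$. *)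

theory Defs
  imports Complex_Main "HOL-Library.Poly_Mapping" "HOL-Library.Product_Plus"
begin

text \<open>
  Laurent polynomials in two indeterminates over the integers, as the group ring of the
  additive group of exponent vectors: the coefficient of \<open>u\<^sup>i v\<^sup>j\<close> is the value at \<open>(i, j)\<close>, and
  the ring multiplication of \<^typ>\<open>(int \<times> int) \<Rightarrow>\<^sub>0 int\<close> is convolution.
\<close>

type_synonym laurent2 = "(int \<times> int) \<Rightarrow>\<^sub>0 int"

definition indet_u :: laurent2 where
  "indet_u = Poly_Mapping.single (1, 0) 1"

definition indet_v :: laurent2 where
  "indet_v = Poly_Mapping.single (0, 1) 1"

text \<open>
  Integer powers in a commutative ring. The library operator \<open>powi\<close> needs a global inverse
  operation, which is not available here. For \<open>n < 0\<close> the value is meaningful only if \<open>x\<close> is a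
  unit; inverses are unique, so the description operator then picks out the inverse of \<open>x\<close>.
\<close>

definition unit_pow :: "'a::comm_ring_1 \<Rightarrow> int \<Rightarrow> 'a" (infixr "\<up>" 80) where
  "x \<up> n = (if 0 \<le> n then x ^ nat n else (THE y. x * y = 1) ^ nat (- n))"

text \<open>
  The Dedekind--Carlitz polynomial \<open>c(u, v; a, b)\<close>, for \<open>b > 0\<close>. The first two arguments are
  arbitrary ring elements, so that Laurent monomials may be substituted for the indeterminates.
  The parameter \<open>a\<close> may be any integer: the values \<open>c x + d y\<close> at which it is used may be
  negative or zero, depending on the solution \<open>(x, y)\<close> of \<open>a x + b y = 1\<close>.
\<close>

definition dedekind_carlitz :: "'a::comm_ring_1 \<Rightarrow> 'a \<Rightarrow> int \<Rightarrow> int \<Rightarrow> 'a" where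
  "dedekind_carlitz u v a b =
     (\<Sum>k = 1..b - 1. u \<up> \<lfloor>real_of_int (k * a) / real_of_int b\<rfloor> * v \<up> (k - 1))"

lemma single_zero_exponent: "Poly_Mapping.single (0, 0) (1::int) = (1::laurent2)"
  by (metis single_one zero_prod_def)

lemma single_power:
  "Poly_Mapping.single (i, j) (1::int) ^ n = Poly_Mapping.single (int n * i, int n * j) 1"
proof (induction n)
  case 0
  show ?case
    by (simp add: single_zero_exponent)
next
  case (Suc n)
  then show ?case
    by (simp add: mult_single distrib_right)
qed

lemma unit_pow_single:
  "Poly_Mapping.single (i, j) (1::int) \<up> n = Poly_Mapping.single (n * i, n * j) 1"
proof (cases "0 \<le> n")
  case False
  let ?x = "Poly_Mapping.single (i, j) (1::int)"
  let ?y = "Poly_Mapping.single (- i, - j) (1::int)"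
  have inv: "?x * ?y = 1"
    by (simp add: mult_single single_zero_exponent)
  have "(THE y. ?x * y = 1) = ?y"
  proof (rule the_equality)
    fix y assume y: "?x * y = 1"
    have "y = (?x * ?y) * y"
      by (simp only: inv mult_1)
    also have "\<dots> = ?y * (?x * y)"
      by (simp only: ac_simps)
    finally show "y = ?y"
      by (simp only: y mult_1_right)
  qed (rule inv)
  with False show ?thesis
    by (simp add: unit_pow_def single_power)
qed (simp add: unit_pow_def single_power)

end

theory Submission
  imports Defs "HOL-Library.Indicator_Function"
begin

text \<open>
  Write \<open>z\<^sup>p\<close> for the monomial with exponent vector \<open>p\<close>, and let \<open>e = (a, b)\<close>, \<open>f = (c, d)\<close>.
  The rays through \<open>e\<close> and \<open>f\<close> split the open first quadrant into three open cones and the two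
  rays. Up to a monomial, each Dedekind--Carlitz polynomial enumerates the lattice points inside
  the parallelogram spanned by the generators of one of the cones. Since the generators are
  primitive, multiplying the (formal) generating function of the cone over \<open>p, q\<close> by
  \<open>(1 - z\<^sup>p) (1 - z\<^sup>q)\<close> leaves exactly these points and \<open>p + q\<close>. Multiplying the decomposition of the
  quadrant by \<open>(1 - u) (1 - v) (1 - z\<^sup>e) (1 - z\<^sup>f)\<close> gives the identity. The infinite generating
  functions are represented by the indicator functions of the cones, on which multiplication by
  \<open>1 - z\<^sup>w\<close> acts as a difference operator.
\<close>

abbreviation monomial :: "int \<times> int \<Rightarrow> laurent2" where
  "monomial p \<equiv> Poly_Mapping.single p 1"

abbreviation coefficient :: "laurent2 \<Rightarrow> int \<times> int \<Rightarrow> int" where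
  "coefficient \<equiv> Poly_Mapping.lookup"

definition det2 :: "int \<times> int \<Rightarrow> int \<times> int \<Rightarrow> int" where
  "det2 p q = fst p * snd q - snd p * fst q"

definition diff_by :: "int \<times> int \<Rightarrow> (int \<times> int \<Rightarrow> int) \<Rightarrow> int \<times> int \<Rightarrow> int" where
  "diff_by w g p = g p - g (p - w)"

definition open_cone :: "int \<times> int \<Rightarrow> int \<times> int \<Rightarrow> (int \<times> int) set" where
  "open_cone e f = {p. 0 < det2 e p \<and> 0 < det2 p f}"

text \<open>This is the ray through \<open>e\<close> only if \<open>0 < fst e\<close>.\<close>

definition open_ray :: "int \<times> int \<Rightarrow> (int \<times> int) set" where
  "open_ray e = {p. det2 e p = 0 \<and> 0 < fst p}"

definition open_parallelogram :: "int \<times> int \<Rightarrow> int \<times> int \<Rightarrow> (int \<times> int) set" where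
  "open_parallelogram e f =
     {p. 0 < det2 e p \<and> det2 e p < det2 e f \<and> 0 < det2 p f \<and> det2 p f < det2 e f}"

lemma coefficient_monomial_times:
  "coefficient (monomial w * F) p = coefficient F (p - w)"
proof -
  have "coefficient (monomial w * F) p = coefficient F (p - w)" if "Poly_Mapping.keys F \<subseteq> UNIV"
    using that
  proof (induction F rule: frag_induction)
    case (one k)
    have "(p = w + k) = (p - w = k)"
      by (auto simp: algebra_simps)
    then show ?case
      by (simp add: mult_single)
  qed (simp_all add: right_diff_distrib lookup_minus)
  then show ?thesis
    by simp
qed

lemma coefficient_one_minus_monomial_times:
  "coefficient ((1 - monomial w) * F) = diff_by w (coefficient F)"
  by (rule ext) (simp add: left_diff_distrib lookup_minus coefficient_monomial_times diff_by_def)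

lemma diff_by_add: "diff_by w (\<lambda>p. g p + h p) = (\<lambda>p. diff_by w g p + diff_by w h p)"
  by (simp add: diff_by_def fun_eq_iff)

lemma diff_by_commute: "diff_by w (diff_by w' g) = diff_by w' (diff_by w g)"
  by (simp add: diff_by_def fun_eq_iff algebra_simps)

lemma det2_eq_0_primitive:
  assumes "det2 (a, b) (i, j) = 0" and "gcd a b = 1"
  obtains m where "i = m * a" and "j = m * b"
proof -
  obtain x y where xy: "x * a + y * b = 1"
    using bezout_int[of a b] assms(2) by metis
  have eq: "a * j = b * i"
    using assms(1) by (simp add: det2_def)
  have "i = (x * i + y * j) * a" "j = (x * i + y * j) * b"
    using xy eq by algebra+
  then show ?thesis
    by (rule that)
qed

lemma diff_by_open_ray:
  assumes "gcd a b = 1" and "0 < a"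
  shows "diff_by (a, b) (indicator (open_ray (a, b))) = coefficient (monomial (a, b))"
proof (rule ext, clarify)
  fix i j
  have shift: "det2 (a, b) ((i, j) - (a, b)) = det2 (a, b) (i, j)"
    by (simp add: det2_def algebra_simps)
  have "i = a \<and> j = b" if det: "det2 (a, b) (i, j) = 0" and i: "0 < i" "i \<le> a"
  proof -
    obtain m where m: "i = m * a" "j = m * b"
      using det2_eq_0_primitive[OF det assms(1)] .
    with i assms(2) have "0 < m" "m \<le> 1"
      by (auto simp: zero_less_mult_iff)
    then show ?thesis
      using m by simp
  qed
  moreover have "det2 (a, b) (a, b) = 0"
    by (simp add: det2_def)
  ultimately show "diff_by (a, b) (indicator (open_ray (a, b))) (i, j) = coefficient (monomial (a, b)) (i, j)"
    using assms(2) shift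
    by (auto simp: diff_by_def open_ray_def indicator_def)
qed

lemma diff_by_open_cone:
  assumes "gcd a b = 1" and "gcd c d = 1" and pos: "0 < det2 (a, b) (c, d)"
    and Q: "coefficient Q = indicator (open_parallelogram (a, b) (c, d))"
  shows "diff_by (a, b) (diff_by (c, d) (indicator (open_cone (a, b) (c, d))))
    = coefficient (Q + monomial (a + c, b + d))"
proof (rule ext, clarify)
  fix i j
  let ?D = "det2 (a, b) (c, d)"
  define \<alpha> where "\<alpha> = det2 (a, b) (i, j)"
  define \<beta> where "\<beta> = det2 (i, j) (c, d)"
  have shift: "det2 (a, b) ((i, j) - (a, b)) = \<alpha>" "det2 ((i, j) - (a, b)) (c, d) = \<beta> - ?D"
    "det2 (a, b) ((i, j) - (c, d)) = \<alpha> - ?D" "det2 ((i, j) - (c, d)) (c, d) = \<beta>"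
    "det2 (a, b) ((i, j) - (a, b) - (c, d)) = \<alpha> - ?D"
    "det2 ((i, j) - (a, b) - (c, d)) (c, d) = \<beta> - ?D"
    by (simp_all add: det2_def \<alpha>_def \<beta>_def algebra_simps)
  have vertex: "i = a + c \<and> j = b + d" if "0 < \<alpha>" "\<alpha> \<le> ?D" "0 < \<beta>" "\<beta> \<le> ?D" "\<alpha> = ?D \<or> \<beta> = ?D"
    using that(5)
  proof
    assume "\<alpha> = ?D"
    then have "det2 (a, b) (i - c, j - d) = 0"
      by (simp add: \<alpha>_def det2_def algebra_simps)
    then obtain m where m: "i - c = m * a" "j - d = m * b"
      using det2_eq_0_primitive assms(1) by metis
    then have "i = m * a + c" "j = m * b + d"
      by simp_all
    then have "\<beta> = m * ?D"
      by (simp add: \<beta>_def det2_def algebra_simps)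
    then have "m = 1"
      using that(3,4) pos by (auto simp: zero_less_mult_iff)
    then show ?thesis
      using m by simp
  next
    assume "\<beta> = ?D"
    then have "det2 (c, d) (i - a, j - b) = 0"
      by (simp add: \<beta>_def det2_def algebra_simps)
    then obtain m where m: "i - a = m * c" "j - b = m * d"
      using det2_eq_0_primitive assms(2) by metis
    then have "i = m * c + a" "j = m * d + b"
      by simp_all
    then have "\<alpha> = m * ?D"
      by (simp add: \<alpha>_def det2_def algebra_simps)
    then have "m = 1"
      using that(1,2) pos by (auto simp: zero_less_mult_iff)
    then show ?thesis
      using m by simp
  qed
  have corner: "\<alpha> = ?D \<and> \<beta> = ?D" if "i = a + c \<and> j = b + d"
    using that by (auto simp: \<alpha>_def \<beta>_def det2_def algebra_simps)
  have "diff_by (a, b) (diff_by (c, d) (indicator (open_cone (a, b) (c, d)))) (i, j)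
      = of_bool (0 < \<alpha> \<and> \<alpha> \<le> ?D \<and> 0 < \<beta> \<and> \<beta> \<le> ?D)"
    unfolding diff_by_def open_cone_def indicator_def mem_Collect_eq shift
      \<alpha>_def[symmetric] \<beta>_def[symmetric]
    using pos by auto
  also have "\<dots> = of_bool (0 < \<alpha> \<and> \<alpha> < ?D \<and> 0 < \<beta> \<and> \<beta> < ?D) + of_bool (i = a + c \<and> j = b + d)"
    using vertex corner pos by (cases "i = a + c \<and> j = b + d") force+
  also have "\<dots> = coefficient (Q + monomial (a + c, b + d)) (i, j)"
    by (simp add: lookup_add Q open_parallelogram_def indicator_def
        \<alpha>_def \<beta>_def)
  finally show "diff_by (a, b) (diff_by (c, d) (indicator (open_cone (a, b) (c, d)))) (i, j)
      = coefficient (Q + monomial (a + c, b + d)) (i, j)" .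
qed

lemma quadrant_decomposition:
  assumes "0 < a" "0 < b" "0 < c" "0 < d" and D: "0 < det2 (a, b) (c, d)"
  shows "indicator (open_cone (1, 0) (0, 1)) p =
    (indicator (open_cone (1, 0) (a, b)) p + indicator (open_ray (a, b)) p
     + indicator (open_cone (a, b) (c, d)) p + indicator (open_ray (c, d)) p
     + indicator (open_cone (c, d) (0, 1)) p :: int)"
proof (cases p)
  case (Pair i j)
  define \<alpha> where "\<alpha> = a * j - b * i"
  define \<beta> where "\<beta> = i * d - j * c"
  define \<delta> where "\<delta> = a * d - b * c"
  have \<delta>: "0 < \<delta>"
    using D by (simp add: \<delta>_def det2_def)
  have J: "b * \<beta> + d * \<alpha> = \<delta> * j" and I: "a * \<beta> + c * \<alpha> = \<delta> * i"
    by (simp_all add: \<alpha>_def \<beta>_def \<delta>_def algebra_simps)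
  have dets: "det2 (1, 0) (i, j) = j" "det2 (i, j) (0, 1) = i" "det2 (i, j) (a, b) = - \<alpha>"
    "det2 (a, b) (i, j) = \<alpha>" "det2 (i, j) (c, d) = \<beta>" "det2 (c, d) (i, j) = - \<beta>"
    by (simp_all add: det2_def \<alpha>_def \<beta>_def algebra_simps)
  have both_pos: "0 < i \<and> 0 < j" if "0 \<le> \<alpha>" "0 \<le> \<beta>" "0 < \<alpha> \<or> 0 < \<beta>"
  proof -
    have "0 < b * \<beta> + d * \<alpha>" "0 < a * \<beta> + c * \<alpha>"
      using that assms(1-4)
      by (auto intro: add_pos_nonneg add_nonneg_pos simp: mult_pos_pos mult_nonneg_nonneg)
    then show ?thesis
      using \<delta> by (simp add: I J zero_less_mult_iff)
  qed
  have not_both: "0 < \<alpha> \<or> 0 < \<beta>" if "0 < i"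
  proof (rule ccontr)
    assume "\<not> ?thesis"
    then have "a * \<beta> + c * \<alpha> \<le> 0"
      using assms(1,3) by (intro add_nonpos_nonpos) (auto simp: mult_nonneg_nonpos)
    then show False
      using that \<delta> by (simp add: I mult_le_0_iff)
  qed
  have left: "0 < i" if "0 < j" "\<alpha> < 0"
  proof -
    have "0 < a * j" "a * j < b * i"
      using that assms(1) by (auto simp: \<alpha>_def)
    then show ?thesis
      using assms(2) by (smt (verit) mult_nonneg_nonpos)
  qed
  have right: "0 < j" if "0 < i" "\<beta> < 0"
  proof -
    have "0 < i * d" "i * d < j * c"
      using that assms(4) by (auto simp: \<beta>_def)
    then show ?thesis
      using assms(3) by (smt (verit) mult_nonpos_nonneg)
  qed
  show ?thesis
    unfolding Pair open_cone_def open_ray_def indicator_def mem_Collect_eq dets fst_conv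
    using both_pos not_both left right
    by (cases \<alpha> "0 :: int" rule: linorder_cases; cases \<beta> "0 :: int" rule: linorder_cases;
        cases "0 < i"; cases "0 < j") simp_all
qed

lemma coefficient_sum_monomial:
  assumes "finite K" and "inj_on h K"
  shows "coefficient (\<Sum>k\<in>K. monomial (h k)) = indicator (h ` K)"
proof (rule ext)
  fix p
  have "coefficient (\<Sum>k\<in>K. monomial (h k)) p = (\<Sum>k\<in>K. of_bool (p = h k))"
    by (simp add: lookup_sum of_bool_def)
  also have "\<dots> = (\<Sum>q\<in>h ` K. of_bool (p = q))"
    using assms(2) by (simp add: sum.reindex)
  also have "\<dots> = indicator (h ` K) p"
    using assms(1) by (simp add: of_bool_def indicator_def)
  finally show "coefficient (\<Sum>k\<in>K. monomial (h k)) p = indicator (h ` K) p" .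
qed

lemma dedekind_carlitz_monomial:
  "monomial (e1 + g1, e2 + g2) * dedekind_carlitz (monomial (e1, e2)) (monomial (g1, g2)) s n =
    (\<Sum>k = 1..n - 1. monomial ((k * s div n + 1) * e1 + k * g1, (k * s div n + 1) * e2 + k * g2))"
  unfolding dedekind_carlitz_def floor_divide_of_int_eq unit_pow_single
  by (simp add: sum_distrib_left mult_single algebra_simps)

text \<open>
  The sign \<open>\<sigma>\<close> is the orientation of the lattice basis \<open>(e1, e2)\<close>, \<open>(g1, g2)\<close>, in which \<open>(c, d)\<close> has
  the coordinates \<open>s\<close> and \<open>n\<close>. The set is the interior of the parallelogram spanned by \<open>(e1, e2)\<close> and
  \<open>(c, d)\<close>; on each line \<open>\<sigma> * det2 (e1, e2) p = k\<close> with \<open>0 < k < n\<close> it contains one lattice point.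
\<close>

lemma coefficient_dedekind_carlitz:
  assumes \<sigma>: "\<sigma> = det2 (e1, e2) (g1, g2)" "\<sigma> * \<sigma> = 1" and "0 < n"
    and f: "c = s * e1 + n * g1" "d = s * e2 + n * g2" and "gcd c d = 1"
  shows "coefficient (monomial (e1 + g1, e2 + g2)
      * dedekind_carlitz (monomial (e1, e2)) (monomial (g1, g2)) s n)
    = indicator {p. 0 < \<sigma> * det2 (e1, e2) p \<and> \<sigma> * det2 (e1, e2) p < n
        \<and> 0 < \<sigma> * det2 p (c, d) \<and> \<sigma> * det2 p (c, d) < n}"
proof -
  define h where "h k = ((k * s div n + 1) * e1 + k * g1, (k * s div n + 1) * e2 + k * g2)" for k
  let ?S = "{p. 0 < \<sigma> * det2 (e1, e2) p \<and> \<sigma> * det2 (e1, e2) p < n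
        \<and> 0 < \<sigma> * det2 p (c, d) \<and> \<sigma> * det2 p (c, d) < n}"
  have \<sigma>1: "\<sigma> * (e1 * g2 - e2 * g1) = 1"
    using \<sigma> by (simp add: det2_def)
  have first: "\<sigma> * det2 (e1, e2) (m * e1 + k * g1, m * e2 + k * g2) = k" for m k
    using \<sigma>1 unfolding det2_def fst_conv snd_conv by algebra
  have second: "\<sigma> * det2 (m * e1 + k * g1, m * e2 + k * g2) (c, d) = n * m - k * s" for m k
    using \<sigma>1 unfolding det2_def fst_conv snd_conv f by algebra
  have coprime: "coprime s n"
  proof (rule coprimeI)
    fix q
    assume "q dvd s" "q dvd n"
    then have "q dvd gcd c d"
      unfolding f by (intro gcd_greatest dvd_add dvd_mult2)
    then show "is_unit q"
      by (simp add: \<open>gcd c d = 1\<close>)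
  qed
  have "inj_on h {1..n - 1}"
  proof (rule inj_onI)
    fix k k'
    assume "h k = h k'"
    then show "k = k'"
      unfolding h_def by (metis first)
  qed
  then have "coefficient (\<Sum>k = 1..n - 1. monomial (h k)) = indicator (h ` {1..n - 1})"
    by (intro coefficient_sum_monomial) simp_all
  moreover have "h ` {1..n - 1} = ?S"
  proof (intro equalityI subsetI)
    fix p
    assume "p \<in> h ` {1..n - 1}"
    then obtain k where k: "0 < k" "k < n" and p: "p = h k"
      by force
    have "\<not> n dvd k * s"
      using coprime k by (metis coprime_commute coprime_dvd_mult_left_iff zdvd_not_zless)
    then have "0 < k * s mod n" "k * s mod n < n"
      using \<open>0 < n\<close> pos_mod_sign[of n "k * s"] pos_mod_bound[of n "k * s"]
      by (auto simp: dvd_eq_mod_eq_0 order_less_le)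
    moreover have "n * (k * s div n + 1) - k * s = n - k * s mod n"
      using mult_div_mod_eq[of n "k * s"] by (simp add: algebra_simps)
    ultimately show "p \<in> ?S"
      unfolding p h_def mem_Collect_eq first second using k by simp
  next
    fix p
    assume S: "p \<in> ?S"
    define k where "k = \<sigma> * det2 (e1, e2) p"
    define m where "m = \<sigma> * det2 p (g1, g2)"
    have p: "p = (m * e1 + k * g1, m * e2 + k * g2)"
    proof (cases p)
      case (Pair i j)
      have "i = m * e1 + k * g1" "j = m * e2 + k * g2"
        using \<sigma>1 unfolding m_def k_def Pair det2_def fst_conv snd_conv by algebra+
      then show ?thesis
        by (simp add: Pair)
    qed
    have k: "0 < k" "k < n" and "0 < n * m - k * s" "n * m - k * s < n"
      using S unfolding p mem_Collect_eq first second by simp_all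
    then have "k * s div n = m - 1"
      by (intro int_div_pos_eq[of _ _ _ "k * s - n * (m - 1)"]) (simp_all add: algebra_simps)
    then have "p = h k"
      by (simp add: p h_def)
    then show "p \<in> h ` {1..n - 1}"
      using k by simp
  qed
  ultimately show ?thesis
    by (simp only: dedekind_carlitz_monomial h_def)
qed

theorem theorem7:
  fixes a b c d x y :: int and u v :: laurent2
  defines "u \<equiv> indet_u" and "v \<equiv> indet_v"
  assumes "a > 0" and "b > 0" and "c > 0" and "d > 0"
    and "a * d > b * c"
    and "gcd a b = 1" and "gcd c d = 1"
    and "a * x + b * y = 1"
  shows
    "u * v * (u - 1) * (u \<up> a * v \<up> b - 1) * dedekind_carlitz v u d c
     + u * v * (v - 1) * (u \<up> c * v \<up> d - 1) * dedekind_carlitz u v a b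
     + u \<up> (a - y) * v \<up> (b + x) * (u - 1) * (v - 1)
         * dedekind_carlitz (u \<up> a * v \<up> b) (u \<up> (- y) * v \<up> x) (c * x + d * y) (a * d - b * c)
     = u \<up> (a + c) * v \<up> (b + d) - u \<up> a * v \<up> b * (u * v - v + 1)
       - u \<up> c * v \<up> d * (u * v - u + 1) + u * v"
proof -
  note uv = u_def v_def indet_u_def indet_v_def
  define E where "E = monomial (a, b)"
  define F where "F = monomial (c, d)"
  define A where "A = u * v * dedekind_carlitz u v a b"
  define B where "B = u * v * dedekind_carlitz v u d c"
  define C where "C = u \<up> (a - y) * v \<up> (b + x)
    * dedekind_carlitz (u \<up> a * v \<up> b) (u \<up> (- y) * v \<up> x) (c * x + d * y) (a * d - b * c)"
  have D: "0 < det2 (a, b) (c, d)"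
    using \<open>a * d > b * c\<close> by (simp add: det2_def)
  have powers: "u \<up> i * v \<up> j = monomial (i, j)" for i j
    by (simp add: uv unit_pow_single mult_single)

  have A: "coefficient A = indicator (open_parallelogram (1, 0) (a, b))"
  proof -
    have "u * v = monomial (1 + 0, 0 + 1)"
      by (simp add: uv mult_single)
    then have "A = monomial (1 + 0, 0 + 1) * dedekind_carlitz (monomial (1, 0)) (monomial (0, 1)) a b"
      by (simp add: A_def uv)
    then show ?thesis
      using coefficient_dedekind_carlitz[of 1 1 0 0 1 b a a b] assms
      by (simp add: det2_def open_parallelogram_def)
  qed
  have B: "coefficient B = indicator (open_parallelogram (c, d) (0, 1))"
  proof -
    have "u * v = monomial (0 + 1, 1 + 0)"
      by (simp add: uv mult_single)
    then have "B = monomial (0 + 1, 1 + 0) * dedekind_carlitz (monomial (0, 1)) (monomial (1, 0)) d c"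
      by (simp add: B_def uv)
    moreover have "open_parallelogram (c, d) (0, 1) = {p. 0 < - 1 * det2 (0, 1) p \<and> - 1 * det2 (0, 1) p < c
        \<and> 0 < - 1 * det2 p (c, d) \<and> - 1 * det2 p (c, d) < c}"
      by (auto simp: open_parallelogram_def det2_def algebra_simps)
    ultimately show ?thesis
      using coefficient_dedekind_carlitz[of "-1" 0 1 1 0 c c d d] assms
      by (simp add: det2_def)
  qed
  have C: "coefficient C = indicator (open_parallelogram (a, b) (c, d))"
  proof -
    have "C = monomial (a + - y, b + x) * dedekind_carlitz (monomial (a, b)) (monomial (- y, x))
      (c * x + d * y) (a * d - b * c)"
      by (simp add: C_def powers)
    moreover have "c = (c * x + d * y) * a + (a * d - b * c) * - y"
      "d = (c * x + d * y) * b + (a * d - b * c) * x"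
      using \<open>a * x + b * y = 1\<close> by algebra+
    moreover have "det2 (a, b) (- y, x) = 1" "det2 (a, b) (c, d) = a * d - b * c"
      using \<open>a * x + b * y = 1\<close> by (simp_all add: det2_def)
    ultimately show ?thesis
      using coefficient_dedekind_carlitz[of 1 a b "- y" x "a * d - b * c" c "c * x + d * y" d] assms
      by (simp add: open_parallelogram_def)
  qed

  have uv_diff: "coefficient ((1 - u) * G) = diff_by (1, 0) (coefficient G)"
    "coefficient ((1 - v) * G) = diff_by (0, 1) (coefficient G)"
    "coefficient ((1 - E) * G) = diff_by (a, b) (coefficient G)"
    "coefficient ((1 - F) * G) = diff_by (c, d) (coefficient G)" for G
    by (simp_all only: uv E_def F_def coefficient_one_minus_monomial_times)

  have cone_A: "coefficient (A + u * E) = diff_by (1, 0) (diff_by (a, b) (indicator (open_cone (1, 0) (a, b))))"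
    using diff_by_open_cone[OF _ \<open>gcd a b = 1\<close> _ A] assms(4)
    by (simp add: det2_def uv E_def mult_single)
  have cone_B: "coefficient (B + v * F) = diff_by (c, d) (diff_by (0, 1) (indicator (open_cone (c, d) (0, 1))))"
    using diff_by_open_cone[OF \<open>gcd c d = 1\<close> _ _ B] assms(5)
    by (simp add: det2_def uv F_def mult_single add.commute)
  have cone_C: "coefficient (C + E * F) = diff_by (a, b) (diff_by (c, d) (indicator (open_cone (a, b) (c, d))))"
    using diff_by_open_cone[OF \<open>gcd a b = 1\<close> \<open>gcd c d = 1\<close> D C]
    by (simp add: E_def F_def mult_single)
  have ray_E: "coefficient E = diff_by (a, b) (indicator (open_ray (a, b)))"
    and ray_F: "coefficient F = diff_by (c, d) (indicator (open_ray (c, d)))"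
    using assms by (simp_all add: diff_by_open_ray E_def F_def)
  have quadrant: "coefficient (u * v) = diff_by (1, 0) (diff_by (0, 1) (indicator (open_cone (1, 0) (0, 1))))"
  proof -
    have "open_parallelogram (1, 0) (0, 1) = {}"
      by (auto simp: open_parallelogram_def det2_def)
    then have "coefficient 0 = indicator (open_parallelogram (1, 0) (0, 1))"
      by (simp add: fun_eq_iff)
    from diff_by_open_cone[OF _ _ _ this] show ?thesis
      by (simp add: det2_def uv mult_single)
  qed

  have split: "(1 - E) * ((1 - F) * (u * v)) =
      (1 - v) * ((1 - F) * (A + u * E)) + (1 - u) * ((1 - v) * ((1 - F) * E))
      + (1 - u) * ((1 - v) * (C + E * F)) + (1 - u) * ((1 - v) * ((1 - E) * F))
      + (1 - u) * ((1 - E) * (B + v * F))" (is "?L = ?R")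
  proof (rule poly_mapping_eqI)
    fix p
    define \<Delta> where "\<Delta> g = diff_by (1, 0) (diff_by (0, 1) (diff_by (a, b) (diff_by (c, d) g)))" for g
    have add: "\<Delta> (\<lambda>p. g p + h p) = (\<lambda>p. \<Delta> g p + \<Delta> h p)" for g h
      by (simp add: \<Delta>_def diff_by_add)
    have "coefficient ?L p = \<Delta> (indicator (open_cone (1, 0) (0, 1))) p"
      unfolding \<Delta>_def uv_diff quadrant by (metis diff_by_commute)
    also have "\<dots> = \<Delta> (\<lambda>p. indicator (open_cone (1, 0) (a, b)) p + indicator (open_ray (a, b)) p
      + indicator (open_cone (a, b) (c, d)) p + indicator (open_ray (c, d)) p
      + indicator (open_cone (c, d) (0, 1)) p) p"
      using assms D by (intro arg_cong[where f = "\<lambda>g. \<Delta> g p"] ext quadrant_decomposition)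
    also have "\<dots> = coefficient ?R p"
      unfolding add lookup_add uv_diff cone_A cone_B cone_C ray_E ray_F \<Delta>_def
      by (smt (verit) diff_by_commute)
    finally show "coefficient ?L p = coefficient ?R p" .
  qed
  have "(u - 1) * (E - 1) * B + (v - 1) * (F - 1) * A + (u - 1) * (v - 1) * C
      = E * F - E * (u * v - v + 1) - F * (u * v - u + 1) + u * v" (is "?l = ?r")
  proof -
    have "?l + ?L = ?r + ?R"
      by (simp add: algebra_simps)
    then show ?thesis
      by (simp only: split add_right_cancel)
  qed
  moreover have "E * F = u \<up> (a + c) * v \<up> (b + d)"
    by (simp add: powers E_def F_def mult_single)
  ultimately show ?thesis
    by (simp add: A_def B_def C_def E_def F_def powers ac_simps)
qed

end
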